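(* Let $f(x)\in\mathbb{Z}[x]$ have degree $d\ge 2$ and let $t\in\mathbb{Z}$ be a wandering point for $f$. Let $r\in(0,1)$ and let $p_1<p_2<p_3<\cdots$ be the sequence of rational primes in increasing order. If $k$ is a positive integer such that $$\delta_k=1-\prod_{i=1}^k\left(1-\frac{1}{p_i}\right)<r,$$ then $r$ is not $(f,t,k)$-accessible. In particular, there do not exist $k$ polynomials $g_1(x)=x+a_1,\dots,g_k(x)=x+a_k$ with $a_i\in\mathbb{Z}$ such that $\delta_{f,t}\left(\bigcup_{i=1}^k\operatorname{Orb}^{\pm}_{g_i}(t)\right)=r$.
   Context: $\operatorname{Orb}_f(t)=\{f^n(t):n\ge0\}$ ($f^0(x)=x$, $f^n=f\circ f^{n-1}$); $t$ is wandering if this set is infinite. For $g(x)=x+a$, $a\in\mathbb{Z}$, $\operatorname{Orb}^{\pm}_g(t)=\{t+na:n\in\mathbb{Z}\}$. For $A\subseteq\mathbb{Z}$, $$\delta_{f,t}(A)=\lim_{X\to\infty}\frac{|\{x\in A\cap \operatorname{Orb}_f(t): x\le X\}|}{|\{x\in\operatorname{Orb}_f(t): x\le X\}|},$$ provided this limit exists. A real number $\delta$ with $0\le\delta\le1$ is $(f,t,k)$-accessible if there is a system of arithmetic progressions $\{t+n_s\mathbb{Z}\}_{s=1}^k$ with positive integers $n_s$ such that $\delta_{f,t}\left(\bigcup_{s=1}^k(t+n_s\mathbb{Z})\right)=\delta$. *)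

theory Defs
  imports Complex_Main "HOL-Library.Infinite_Set" "HOL-Computational_Algebra.Polynomial"
    "HOL-Computational_Algebra.Primes"
begin

definition orb :: "int poly \<Rightarrow> int \<Rightarrow> int set" where
  "orb f t = {(poly f ^^ n) t | n. True}"

definition wandering :: "int poly \<Rightarrow> int \<Rightarrow> bool" where
  "wandering f t \<longleftrightarrow> infinite (orb f t)"

text \<open>Only meaningful for the translations \<open>g(x) = x + a\<close>.\<close>

definition orb_pm :: "int poly \<Rightarrow> int \<Rightarrow> int set" where
  "orb_pm g t = {t + n * a | n a. g = [:a, 1:]}"

definition arith_prog :: "int \<Rightarrow> int \<Rightarrow> int set" where
  "arith_prog t n = {t + n * m | m. True}"

text \<open>
  \<open>has_orb_density f t A \<delta>\<close> says that the density \<open>\<delta>\<^sub>f\<^sub>,\<^sub>t(A)\<close> exists and equals \<open>\<delta>\<close>.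
  The orbit may be unbounded below, in which case infinitely many of its points are at most \<open>X\<close>
  and the quotient of cardinalities is undefined. As \<^const>\<open>card\<close> is \<open>0\<close> on infinite sets,
  this case is excluded explicitly: the density then does not exist.
\<close>

definition has_orb_density :: "int poly \<Rightarrow> int \<Rightarrow> int set \<Rightarrow> real \<Rightarrow> bool" where
  "has_orb_density f t A \<delta> \<longleftrightarrow>
     (\<forall>X::real. finite {x \<in> orb f t. real_of_int x \<le> X}) \<and>
     ((\<lambda>X::real. real (card {x \<in> A \<inter> orb f t. real_of_int x \<le> X}) /
                 real (card {x \<in> orb f t. real_of_int x \<le> X})) \<longlongrightarrow> \<delta>) at_top"

definition accessible :: "int poly \<Rightarrow> int \<Rightarrow> nat \<Rightarrow> real \<Rightarrow> bool" where
  "accessible f t k \<delta> \<longleftrightarrow> 0 \<le> \<delta> \<and> \<delta> \<le> 1 \<and>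
     (\<exists>n :: nat \<Rightarrow> int. (\<forall>s\<in>{1..k}. n s > 0) \<and>
        has_orb_density f t (\<Union>s\<in>{1..k}. arith_prog t (n s)) \<delta>)"

text \<open>The primes in increasing order, indexed from \<open>1\<close>: \<open>nth_prime 1 = 2\<close>.\<close>

definition nth_prime :: "nat \<Rightarrow> nat" where
  "nth_prime i = enumerate {p. prime p} (i - 1)"

definition delta_bound :: "nat \<Rightarrow> real" where
  "delta_bound k = 1 - (\<Prod>i=1..k. 1 - 1 / real (nth_prime i))"

end

theory Submission
  imports Defs "HOL-Number_Theory.Totient"
begin

text \<open>
  The times at which the orbit of \<open>t\<close> returns to \<open>t\<close> modulo \<open>n\<close> are \<open>{0}\<close> or the multiples of
  the first return time \<open>c\<close>. If the density exists, then the orbit is eventually increasing, so the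
  density is the natural density of the set of indices. If some progression has \<open>c = 1\<close>, it is
  \<open>1\<close>. Otherwise each \<open>c\<close> has a prime divisor \<open>q\<close>, and the index set is covered by the multiples
  of at most \<open>k\<close> primes, a set of density \<open>1 - \<Prod>(1 - 1/q)\<close>, which is largest for the first \<open>k\<close>
  primes. It suffices to count below the powers of \<open>\<Prod>q\<close>, where Euler's totient is exact.
\<close>

section \<open>Arithmetic of the orbit: congruences, injectivity, return times\<close>

lemma dvd_diff_poly:
  fixes f :: "int poly"
  assumes "n dvd a - b"
  shows "n dvd poly f a - poly f b"
proof (induction f)
  case (pCons c f)
  have "poly (pCons c f) a - poly (pCons c f) b = (a - b) * poly f a + b * (poly f a - poly f b)"
    by (simp add: algebra_simps)
  then show ?case
    using assms pCons.IH by simp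
qed simp

lemma dvd_diff_funpow_poly:
  fixes f :: "int poly"
  assumes "n dvd a - b"
  shows "n dvd (poly f ^^ m) a - (poly f ^^ m) b"
  by (induction m) (auto simp: assms dvd_diff_poly)

text \<open>Induction along Horner's scheme: by integrality a positive \<open>poly p x\<close> is at
  least 1, so \<open>x * poly p x\<close> is at least \<open>x\<close>, which outweighs the constant
  term once \<open>x\<close> exceeds its absolute value.\<close>

lemma int_poly_eventually_pos:
  fixes p :: "int poly"
  assumes "lead_coeff p > 0"
  shows "\<exists>N. \<forall>x\<ge>N. poly p x > 0"
  using assms
proof (induction p)
  case (pCons a p)
  show ?case
  proof (cases "p = 0")
    case True
    then show ?thesis using pCons.prems by auto
  next
    case False
    then obtain N where N: "\<And>x. x \<ge> N \<Longrightarrow> poly p x > 0"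
      using pCons by auto
    have "poly (pCons a p) x > 0" if "x \<ge> max N (\<bar>a\<bar> + 1)" for x
    proof -
      have "x * 1 \<le> x * poly p x"
        by (rule mult_left_mono) (use that N[of x] in auto)
      then show ?thesis using that unfolding poly_pCons by linarith
    qed
    then show ?thesis by blast
  qed
qed simp

lemma orb_altdef: "orb f t = range (\<lambda>m. (poly f ^^ m) t)"
  by (auto simp: orb_def)

text \<open>A repetition at times \<open>i < j\<close> folds every time \<open>m \<ge> j\<close>
  down to the smaller time \<open>m - j + i\<close>, so all values already occur before time
  \<open>j\<close> and the orbit is finite.\<close>

lemma inj_funpow_if_wandering:
  assumes "wandering f t"
  shows "inj (\<lambda>m. (poly f ^^ m) t)"
proof (rule linorder_injI, rule notI)
  fix i j :: nat
  assume ij: "i < j" and eq: "(poly f ^^ i) t = (poly f ^^ j) t"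
  have "(poly f ^^ m) t \<in> (\<lambda>m. (poly f ^^ m) t) ` {..<j}" for m
  proof (induction m rule: less_induct)
    case (less m)
    show ?case
    proof (cases "m < j")
      case False
      have "(poly f ^^ m) t = (poly f ^^ (m - j)) ((poly f ^^ j) t)"
        using False by (simp flip: funpow_add[THEN fun_cong, unfolded o_apply])
      also have "\<dots> = (poly f ^^ (m - j + i)) t"
        by (simp add: funpow_add eq)
      finally show ?thesis
        using less[of "m - j + i"] ij False by simp
    qed auto
  qed
  then have "orb f t \<subseteq> (\<lambda>m. (poly f ^^ m) t) ` {..<j}"
    by (auto simp: orb_altdef)
  then show False
    using assms finite_subset unfolding wandering_def by blast
qed

text \<open>An orbit modulo \<open>n\<close> is in general only eventually periodic, so it may never
  come back to \<open>t\<close>; hence the case split. Passing from the first return time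
  \<open>c\<close> to a prime divisor enlarges the set of times, which suits an upper bound on the
  density. The assumption says that 1 is not a return time.\<close>

lemma return_times_subset_prime_multiples:
  fixes f :: "int poly"
  assumes "\<not> n dvd poly f t - t"
  obtains q where "prime (q::nat)" "\<And>m. n dvd (poly f ^^ m) t - t \<Longrightarrow> q dvd m"
proof (cases "\<exists>m>0. n dvd (poly f ^^ m) t - t")
  case False
  show ?thesis
  proof
    \<comment> \<open>Time 0 is the only return time here, so any prime serves.\<close>
    show "prime (2::nat)" by simp
    show "2 dvd m" if "n dvd (poly f ^^ m) t - t" for m
      using False that by (cases m) auto
  qed
next
  case True
  define c where "c = (LEAST m. 0 < m \<and> n dvd (poly f ^^ m) t - t)"
  have c: "c > 0" "n dvd (poly f ^^ c) t - t"
    using LeastI_ex[OF True] by (auto simp: c_def)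
  have min: "c \<le> m" if "m > 0" "n dvd (poly f ^^ m) t - t" for m
    unfolding c_def using that by (intro Least_le) auto
  have c_dvd: "c dvd m" if "n dvd (poly f ^^ m) t - t" for m
    using that
  proof (induction m rule: less_induct)
    case (less m)
    show ?case
    proof (cases "m = 0")
      case False
      then have "c \<le> m" using min less.prems by simp
      \<comment> \<open>Iterating \<open>m - c\<close> times from the congruent points at times
        \<open>c\<close> and 0 shows that \<open>m - c\<close> is again a return time; thus
        \<open>c\<close> can be subtracted until 0 remains.\<close>
      have "n dvd (poly f ^^ (m - c)) ((poly f ^^ c) t) - (poly f ^^ (m - c)) t"
        by (intro dvd_diff_funpow_poly c)
      also have "(poly f ^^ (m - c)) ((poly f ^^ c) t) = (poly f ^^ m) t"
        using \<open>c \<le> m\<close> by (simp flip: funpow_add[THEN fun_cong, unfolded o_apply])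
      finally have "n dvd ((poly f ^^ m) t - t) - ((poly f ^^ m) t - (poly f ^^ (m - c)) t)"
        using less.prems dvd_diff by blast
      then have "n dvd (poly f ^^ (m - c)) t - t" by simp
      then have "c dvd m - c"
        using less.IH[of "m - c"] c \<open>c \<le> m\<close> by simp
      then show ?thesis using \<open>c \<le> m\<close>
        by (metis dvd_add_right_iff dvd_refl le_add_diff_inverse)
    qed simp
  qed
  have "c \<noteq> 1" using c assms by auto
  then obtain q where "prime q" "q dvd c"
    using prime_factor_nat by blast
  then show ?thesis
    using c_dvd by (intro that[of q]) (auto intro: dvd_trans)
qed

section \<open>Growth of the orbit and passage to the density of indices\<close>

lemma orbit_tendsto_at_top:
  assumes inj: "inj (\<lambda>m. (poly f ^^ m) t)"
    and fin: "\<And>X::real. finite {x \<in> orb f t. real_of_int x \<le> X}"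
  shows "eventually (\<lambda>m. (poly f ^^ m) t > B) sequentially"
proof -
  \<comment> \<open>By injectivity, finitely many small values are attained at finitely many
    times.\<close>
  have "finite ((\<lambda>m. (poly f ^^ m) t) -` {x \<in> orb f t. real_of_int x \<le> of_int B})"
    by (intro finite_vimageI fin inj)
  then have "finite {m. (poly f ^^ m) t \<le> B}"
    by (rule rev_finite_subset) (auto simp: orb_altdef)
  then have "eventually (\<lambda>m. \<not> (poly f ^^ m) t \<le> B) cofinite"
    by (simp add: eventually_cofinite)
  then show ?thesis
    by (simp add: cofinite_eq_sequentially not_le)
qed

text \<open>The polynomial \<open>f(x) - x\<close> is nonzero since the degree is at least 2, so its
  sign is constant for large \<open>x\<close>. The orbit tends to infinity and hence ends up in that
  range; a negative sign would make it decrease from there on and stay bounded above, a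
  contradiction.\<close>

lemma orbit_eventually_increasing:
  assumes deg: "degree f \<ge> 2"
    and inj: "inj (\<lambda>m. (poly f ^^ m) t)"
    and fin: "\<And>X::real. finite {x \<in> orb f t. real_of_int x \<le> X}"
  obtains M where "\<And>m. m \<ge> M \<Longrightarrow> (poly f ^^ m) t < (poly f ^^ Suc m) t"
proof -
  define p where "p = f - [:0, 1:]"
  have "p \<noteq> 0" using deg by (auto simp: p_def)
  note lim = orbit_tendsto_at_top[OF inj fin]
  show ?thesis
  proof (cases "lead_coeff p > 0")
    case True
    then obtain N where N: "\<And>x. x \<ge> N \<Longrightarrow> poly p x > 0"
      using int_poly_eventually_pos by blast
    obtain M where "\<And>m. m \<ge> M \<Longrightarrow> (poly f ^^ m) t > N"
      using lim unfolding eventually_sequentially by blast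
    then have "(poly f ^^ m) t < (poly f ^^ Suc m) t" if "m \<ge> M" for m
      using N[of "(poly f ^^ m) t"] that by (force simp: p_def)
    then show ?thesis using that by blast
  next
    case False
    then have "lead_coeff (- p) > 0"
      using \<open>p \<noteq> 0\<close> by (simp add: order_less_le)
    then obtain N where N: "\<And>x. x \<ge> N \<Longrightarrow> poly (- p) x > 0"
      using int_poly_eventually_pos by blast
    obtain M where M: "\<And>m. m \<ge> M \<Longrightarrow> (poly f ^^ m) t > N"
      using lim unfolding eventually_sequentially by blast
    have "(poly f ^^ m) t \<le> (poly f ^^ M) t" if "m \<ge> M" for m
      using that
    proof (induction m rule: dec_induct)
      case (step m)
      then show ?case
        using N[of "(poly f ^^ m) t"] M[of m] by (force simp: p_def)
    qed simp
    moreover obtain M' where "\<And>m. m \<ge> M' \<Longrightarrow> (poly f ^^ m) t > (poly f ^^ M) t"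
      using lim unfolding eventually_sequentially by blast
    ultimately show ?thesis
      by (meson linorder_not_le max.cobounded1 max.cobounded2)
  qed
qed

text \<open>This turns counting by size into counting by time. The first values may be in disorder,
  so \<open>m\<close> is taken beyond the point \<open>M\<close> where the increase begins and so
  late that its value also exceeds their maximum \<open>B\<close>.\<close>

lemma orbit_initial_segment:
  assumes deg: "degree f \<ge> 2"
    and inj: "inj (\<lambda>m. (poly f ^^ m) t)"
    and fin: "\<And>X::real. finite {x \<in> orb f t. real_of_int x \<le> X}"
  shows "\<forall>\<^sub>F m in sequentially. \<forall>i. (poly f ^^ i) t \<le> (poly f ^^ m) t \<longleftrightarrow> i \<le> m"
proof -
  obtain M where M: "\<And>m. m \<ge> M \<Longrightarrow> (poly f ^^ m) t < (poly f ^^ Suc m) t"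
    using orbit_eventually_increasing[OF assms] by blast
  have mono: "(poly f ^^ i) t < (poly f ^^ j) t" if "M \<le> i" "i < j" for i j
    using lift_Suc_mono_less[of "\<lambda>n. (poly f ^^ (M + n)) t" "i - M" "j - M"] M that by auto
  define B where "B = Max ((\<lambda>i. (poly f ^^ i) t) ` {..M})"
  have B: "(poly f ^^ i) t \<le> B" if "i \<le> M" for i
    unfolding B_def using that by (intro Max_ge) auto
  from orbit_tendsto_at_top[OF inj fin, of B] eventually_ge_at_top[of M]
  show ?thesis
  proof eventually_elim
    case (elim m)
    show ?case
    proof (intro allI iffI)
      fix i assume "(poly f ^^ i) t \<le> (poly f ^^ m) t"
      then show "i \<le> m" using mono[of m i] elim by force
    next
      fix i assume "i \<le> m"
      then show "(poly f ^^ i) t \<le> (poly f ^^ m) t"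
        using mono[of i m] B[of i] elim
        by (cases "i \<le> M"; cases "i = m") auto
    qed
  qed
qed

lemma card_orb_initial_segment:
  assumes inj: "inj (\<lambda>m. (poly f ^^ m) t)"
    and m: "\<forall>i. (poly f ^^ i) t \<le> (poly f ^^ m) t \<longleftrightarrow> i \<le> m"
  shows "card {x \<in> A \<inter> orb f t. real_of_int x \<le> real_of_int ((poly f ^^ m) t)} =
           card {i. i \<le> m \<and> (poly f ^^ i) t \<in> A}"
proof -
  have "{x \<in> A \<inter> orb f t. real_of_int x \<le> real_of_int ((poly f ^^ m) t)} =
          (\<lambda>i. (poly f ^^ i) t) ` {i. i \<le> m \<and> (poly f ^^ i) t \<in> A}"
    using m by (auto simp: orb_altdef)
  then show ?thesis
    using inj by (simp add: card_image inj_on_subset)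
qed

text \<open>The limit over real \<open>X\<close> is evaluated along the thresholds given by the
  orbit points themselves, which tend to infinity and cut off initial segments of times.\<close>

lemma card_index_ratio_tendsto:
  assumes deg: "degree f \<ge> 2" and wand: "wandering f t"
    and dens: "has_orb_density f t A r"
  shows "(\<lambda>m. real (card {i. i \<le> m \<and> (poly f ^^ i) t \<in> A}) / real (Suc m)) \<longlonglongrightarrow> r"
proof -
  note inj = inj_funpow_if_wandering[OF wand]
  have fin: "finite {x \<in> orb f t. real_of_int x \<le> X}" for X
    using dens by (simp add: has_orb_density_def)
  have "filterlim (\<lambda>m. real_of_int ((poly f ^^ m) t)) at_top sequentially"
    unfolding filterlim_at_top
  proof
    fix Z :: real
    show "\<forall>\<^sub>F m in sequentially. Z \<le> real_of_int ((poly f ^^ m) t)"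
      using orbit_tendsto_at_top[OF inj fin, of "\<lceil>Z\<rceil>"]
      by eventually_elim linarith
  qed
  then have "(\<lambda>m. real (card {x \<in> A \<inter> orb f t. real_of_int x \<le> real_of_int ((poly f ^^ m) t)}) /
      real (card {x \<in> orb f t. real_of_int x \<le> real_of_int ((poly f ^^ m) t)})) \<longlonglongrightarrow> r"
    using dens unfolding has_orb_density_def by (elim conjE) (rule filterlim_compose)
  then show ?thesis
  proof (rule Lim_transform_eventually)
    show "\<forall>\<^sub>F m in sequentially.
        real (card {x \<in> A \<inter> orb f t. real_of_int x \<le> real_of_int ((poly f ^^ m) t)}) /
        real (card {x \<in> orb f t. real_of_int x \<le> real_of_int ((poly f ^^ m) t)}) =
        real (card {i. i \<le> m \<and> (poly f ^^ i) t \<in> A}) / real (Suc m)"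
      using orbit_initial_segment[OF deg inj fin]
    proof eventually_elim
      case (elim m)
      \<comment> \<open>The instance with \<open>UNIV\<close> counts the denominator; it is
        \<open>Suc m\<close> because times start at 0.\<close>
      have "{i. i \<le> m} = {..m}" by auto
      then show ?case
        using card_orb_initial_segment[OF inj elim, of A]
          card_orb_initial_segment[OF inj elim, of UNIV] by simp
    qed
  qed
qed

section \<open>Counting the multiples of finitely many primes\<close>

lemma card_multiples_of_primes:
  fixes Q :: "nat set"
  assumes Q: "finite Q" "Q \<noteq> {}" "\<And>q. q \<in> Q \<Longrightarrow> prime q" and "j > 0"
  shows "real (card {m. m < (\<Prod>Q) ^ j \<and> (\<exists>q\<in>Q. q dvd m)}) =
           real ((\<Prod>Q) ^ j) * (1 - (\<Prod>q\<in>Q. 1 - 1 / real q))"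
proof -
  define N where "N = (\<Prod>Q) ^ j"
  have pos: "\<Prod>Q > 0"
    using Q by (intro prod_pos) (auto simp: prime_gt_0_nat)
  \<comment> \<open>A prime dividing a power of the product divides, hence equals, a member of
    \<open>Q\<close>; conversely, \<open>j > 0\<close> keeps every member of \<open>Q\<close> as a
    factor.\<close>
  have pf: "prime_factors N = Q"
  proof -
    have "q \<in> prime_factors N \<longleftrightarrow> q \<in> Q" for q
    proof -
      have "q \<in> prime_factors N \<longleftrightarrow> prime q \<and> (\<exists>p\<in>Q. q dvd p)"
        using pos \<open>j > 0\<close> Q
        by (auto simp: N_def in_prime_factors_iff prime_dvd_power_iff prime_dvd_prod_iff)
      also have "\<dots> \<longleftrightarrow> q \<in> Q"
        using Q(3) primes_dvd_imp_eq dvd_refl by metis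
      finally show ?thesis .
    qed
    then show ?thesis by blast
  qed
  obtain q0 where q0: "q0 \<in> Q" using Q by blast
  have "N > 1"
  proof -
    have "q0 dvd N" using q0 pf by auto
    moreover have "N > 0" using pos by (simp add: N_def)
    ultimately show ?thesis
      using Q(3)[OF q0] by (metis dvd_imp_le order_less_le_trans prime_gt_1_nat)
  qed
  have cop: "coprime m N \<longleftrightarrow> (\<forall>q\<in>Q. \<not> q dvd m)" for m
  proof
    assume "coprime m N"
    then show "\<forall>q\<in>Q. \<not> q dvd m"
      using pf Q by (metis coprime_common_divisor in_prime_factors_imp_dvd not_prime_unit)
  next
    assume "\<forall>q\<in>Q. \<not> q dvd m"
    then have "\<And>q. q \<in> Q \<Longrightarrow> coprime m q"
      using Q(3) prime_imp_coprime coprime_commute by blast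
    then show "coprime m N"
      by (auto simp: N_def intro!: prod_coprime_right)
  qed
  \<comment> \<open>Totatives are taken from 1 to \<open>N\<close>, the count here from 0 to
    \<open>N - 1\<close>. Neither end matters: \<open>N > 1\<close> is not coprime to itself, and 0
    is a multiple of \<open>q0\<close>.\<close>
  have "totatives N = {..<N} - {m. m < N \<and> (\<exists>q\<in>Q. q dvd m)}"
  proof (intro equalityI subsetI)
    fix m assume "m \<in> totatives N"
    then show "m \<in> {..<N} - {m. m < N \<and> (\<exists>q\<in>Q. q dvd m)}"
      using totatives_less[of m N] \<open>N > 1\<close> cop by (auto simp: in_totatives_iff)
  next
    fix m assume "m \<in> {..<N} - {m. m < N \<and> (\<exists>q\<in>Q. q dvd m)}"
    then have m: "m < N" "\<forall>q\<in>Q. \<not> q dvd m" by auto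
    have "m > 0" using m(2) q0 by (cases m) auto
    then show "m \<in> totatives N"
      using m cop by (simp add: in_totatives_iff)
  qed
  then have "totient N = N - card {m. m < N \<and> (\<exists>q\<in>Q. q dvd m)}"
    using card_Diff_subset[of "{m. m < N \<and> (\<exists>q\<in>Q. q dvd m)}" "{..<N}"]
    by (simp add: totient_def subset_iff)
  moreover have "card {m. m < N \<and> (\<exists>q\<in>Q. q dvd m)} \<le> card {..<N}"
    by (intro card_mono) auto
  ultimately have "real (card {m. m < N \<and> (\<exists>q\<in>Q. q dvd m)}) = real N - real (totient N)"
    by simp
  also have "\<dots> = real N * (1 - (\<Prod>q\<in>Q. 1 - 1 / real q))"
    by (simp add: totient_formula2 pf algebra_simps)
  finally show ?thesis by (simp add: N_def)
qed

section \<open>Extremality of the first primes\<close>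

lemma infinite_primes_nat: "infinite {p::nat. prime p}"
  using primes_infinite by blast

lemma prime_nth_prime: "prime (nth_prime i)"
  using enumerate_in_set[OF infinite_primes_nat] by (simp add: nth_prime_def)

text \<open>Pigeonhole: otherwise all of \<open>Q\<close> would lie among the first
  \<open>card Q - 1\<close> primes.\<close>

lemma nth_prime_card_le_Max:
  fixes Q :: "nat set"
  assumes Q: "finite Q" "Q \<noteq> {}" "\<And>q. q \<in> Q \<Longrightarrow> prime q"
  shows "nth_prime (card Q) \<le> Max Q"
proof (rule ccontr)
  assume "\<not> ?thesis"
  then have less: "Max Q < enumerate {p. prime p} (card Q - 1)"
    by (simp add: nth_prime_def)
  have "Q \<subseteq> enumerate {p. prime p} ` {..<card Q - 1}"
  proof
    fix q assume q: "q \<in> Q"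
    then obtain i where i: "enumerate {p. prime p} i = q"
      using enumerate_Ex[of "{p::nat. prime p}" q] infinite_primes_nat Q by blast
    have "q \<le> Max Q" using Q q by simp
    then have "enumerate {p::nat. prime p} i < enumerate {p. prime p} (card Q - 1)"
      unfolding i using less by (rule order_le_less_trans)
    then have "i < card Q - 1"
      by (simp only: enumerate_mono_iff[OF infinite_primes_nat])
    then show "q \<in> enumerate {p. prime p} ` {..<card Q - 1}"
      using i by blast
  qed
  then have "card Q \<le> card Q - 1"
    using surj_card_le[of "{..<card Q - 1}" Q] by simp
  moreover have "card Q > 0" using Q by (simp add: card_gt_0_iff)
  ultimately show False by simp
qed

text \<open>Induction by removing the largest prime \<open>M\<close> of \<open>Q\<close>: its factor
  is compared with that of the last of the first \<open>card Q\<close> primes, which is at most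
  \<open>M\<close>, and the remaining factors are covered by the induction hypothesis.\<close>

lemma prod_first_primes_le:
  assumes "finite Q" "\<And>q. q \<in> Q \<Longrightarrow> prime q"
  shows "(\<Prod>i=1..card Q. 1 - 1 / real (nth_prime i)) \<le> (\<Prod>q\<in>Q. 1 - 1 / real q)"
  using assms
proof (induction "card Q" arbitrary: Q)
  case (Suc n)
  then have ne: "Q \<noteq> {}" by auto
  define M where "M = Max Q"
  have M: "M \<in> Q" using Suc ne by (simp add: M_def)
  have card: "card (Q - {M}) = n" using M Suc by simp
  have le: "nth_prime (Suc n) \<le> M"
    using nth_prime_card_le_Max[of Q] Suc ne by (simp add: M_def)
  have pos: "nth_prime (Suc n) > 1"
    using prime_nth_prime prime_gt_1_nat by blast
  have "(\<Prod>i=1..card Q. 1 - 1 / real (nth_prime i)) =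
      (\<Prod>i=1..n. 1 - 1 / real (nth_prime i)) * (1 - 1 / real (nth_prime (Suc n)))"
    by (simp flip: Suc.hyps(2))
  also have "\<dots> \<le> (\<Prod>q\<in>Q - {M}. 1 - 1 / real q) * (1 - 1 / real M)"
  proof (rule mult_mono)
    show "(\<Prod>i=1..n. 1 - 1 / real (nth_prime i)) \<le> (\<Prod>q\<in>Q - {M}. 1 - 1 / real q)"
      using Suc.hyps(1)[of "Q - {M}"] Suc.prems card by simp
    show "1 - 1 / real (nth_prime (Suc n)) \<le> 1 - 1 / real M"
      using le pos by (simp add: frac_le)
    show "0 \<le> (\<Prod>q\<in>Q - {M}. 1 - 1 / real q)"
    proof (rule prod_nonneg)
      fix q assume "q \<in> Q - {M}"
      then have "q > 1" using Suc.prems prime_gt_1_nat by blast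
      then show "0 \<le> 1 - 1 / real q" by simp
    qed
    show "0 \<le> 1 - 1 / real (nth_prime (Suc n))" using pos by simp
  qed
  also have "\<dots> = (\<Prod>q\<in>Q. 1 - 1 / real q)"
    using M Suc.prems by (simp add: prod.remove[of Q M] mult.commute)
  finally show ?case .
qed simp

text \<open>Several progressions may share a prime, so \<open>Q\<close> can have fewer than
  \<open>k\<close> elements; the extra factors up to \<open>k\<close> lie between 0 and 1 and only
  lower the product.\<close>

lemma delta_bound_ge:
  assumes "finite Q" "\<And>q. q \<in> Q \<Longrightarrow> prime q" "card Q \<le> k"
  shows "1 - (\<Prod>q\<in>Q. 1 - 1 / real q) \<le> delta_bound k"
proof -
  have bounds: "0 \<le> 1 - 1 / real (nth_prime i) \<and> 1 - 1 / real (nth_prime i) \<le> 1" for i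
    using prime_gt_1_nat[OF prime_nth_prime[of i]] by simp
  have "(\<Prod>i=1..k. 1 - 1 / real (nth_prime i)) \<le> (\<Prod>i=1..card Q. 1 - 1 / real (nth_prime i))"
  proof -
    let ?g = "\<lambda>i. 1 - 1 / real (nth_prime i)"
    have "prod ?g {1..k} = prod ?g ({1..k} - {1..card Q}) * prod ?g {1..card Q}"
      using assms(3) by (intro prod.subset_diff) auto
    also have "\<dots> \<le> 1 * prod ?g {1..card Q}"
      using bounds by (intro mult_right_mono prod_le_1 prod_nonneg) blast+
    finally show ?thesis by simp
  qed
  also have "\<dots> \<le> (\<Prod>q\<in>Q. 1 - 1 / real q)"
    by (rule prod_first_primes_le) (use assms in auto)
  finally show ?thesis by (simp add: delta_bound_def)
qed

section \<open>Density of a union of progressions through \<open>t\<close>\<close>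

lemma mem_arith_prog_iff: "x \<in> arith_prog t n \<longleftrightarrow> n dvd x - t"
  by (simp add: arith_prog_def dvd_def diff_eq_eq add.commute)

text \<open>The moduli range over all integers so that both claims of the theorem follow: the shifts
  \<open>a\<close> of the translations may be negative or zero.\<close>

lemma not_has_orb_density_arith_progs:
  fixes n :: "nat \<Rightarrow> int"
  assumes deg: "degree f \<ge> 2" and wand: "wandering f t"
    and "r < 1" "k > 0" "delta_bound k < r"
  shows "\<not> has_orb_density f t (\<Union>s\<in>{1..k}. arith_prog t (n s)) r"
proof
  define A where "A = (\<Union>s\<in>{1..k}. arith_prog t (n s))"
  define a where "a = (\<lambda>m. real (card {i. i \<le> m \<and> (poly f ^^ i) t \<in> A}) / real (Suc m))"
  assume "has_orb_density f t (\<Union>s\<in>{1..k}. arith_prog t (n s)) r"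
  then have lim: "a \<longlonglongrightarrow> r"
    unfolding a_def A_def by (rule card_index_ratio_tendsto[OF deg wand])
  show False
  proof (cases "\<exists>s\<in>{1..k}. n s dvd poly f t - t")
    case True
    then obtain s where s: "s \<in> {1..k}" "n s dvd poly f t - t" by blast
    \<comment> \<open>Here \<open>t\<close> is fixed by \<open>f\<close> modulo \<open>n s\<close>,
      so the whole orbit lies in a single progression.\<close>
    have "n s dvd (poly f ^^ i) t - t" for i
    proof (induction i)
      case (Suc i)
      then have "n s dvd poly f ((poly f ^^ i) t) - poly f t" by (rule dvd_diff_poly)
      from dvd_add[OF this s(2)] show ?case by simp
    qed simp
    then have "(poly f ^^ i) t \<in> A" for i
      using s(1) unfolding A_def mem_arith_prog_iff[symmetric] by blast
    moreover have "{i. i \<le> m} = {..m}" for m :: nat by auto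
    ultimately have "a = (\<lambda>_. 1)" by (auto simp: a_def)
    then have "r = 1" using lim by (simp add: LIMSEQ_const_iff)
    then show False using \<open>r < 1\<close> by simp
  next
    case False
    then have "\<forall>s\<in>{1..k}. \<exists>q. prime q \<and> (\<forall>m. n s dvd (poly f ^^ m) t - t \<longrightarrow> q dvd m)"
      using return_times_subset_prime_multiples by metis
    then obtain q :: "nat \<Rightarrow> nat" where
      q: "\<And>s. s \<in> {1..k} \<Longrightarrow> prime (q s)"
        "\<And>s m. s \<in> {1..k} \<Longrightarrow> n s dvd (poly f ^^ m) t - t \<Longrightarrow> q s dvd m"
      by metis
    define Q where "Q = q ` {1..k}"
    have Q: "finite Q" "Q \<noteq> {}" "\<And>p. p \<in> Q \<Longrightarrow> prime p" "card Q \<le> k"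
      using q(1) \<open>k > 0\<close> card_image_le[of "{1..k}" q] by (auto simp: Q_def)
    define P where "P = \<Prod>Q"
    have "P > 1"
    proof -
      obtain p where p: "p \<in> Q" using Q by blast
      have "P > 0"
        unfolding P_def using Q by (intro prod_pos) (auto simp: prime_gt_0_nat)
      moreover have "p dvd P"
        unfolding P_def using Q(1) p by (rule dvd_prodI)
      ultimately have "p \<le> P" by (intro dvd_imp_le)
      then show ?thesis using prime_gt_1_nat[OF Q(3)[OF p]] by simp
    qed
    \<comment> \<open>The times from 0 to \<open>m j\<close> number exactly
      \<open>P ^ Suc j\<close>, a full range for the totient count, whose exponent has to be
      positive.\<close>
    define m where "m = (\<lambda>j. P ^ Suc j - 1)"
    have Suc_m: "Suc (m j) = P ^ Suc j" for j
      using \<open>P > 1\<close> by (simp add: m_def)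
    have "strict_mono m"
      using \<open>P > 1\<close> by (simp add: strict_mono_Suc_iff m_def diff_less_mono)
    then have "(\<lambda>j. a (m j)) \<longlonglongrightarrow> r"
      using LIMSEQ_subseq_LIMSEQ[OF lim] by (simp add: o_def)
    \<comment> \<open>Since \<open>a\<close> converges, a bound along this subsequence already
      bounds its limit \<open>r\<close>.\<close>
    moreover have "a (m j) \<le> delta_bound k" for j
    proof -
      have "{i. i \<le> m j \<and> (poly f ^^ i) t \<in> A} \<subseteq> {i. i < P ^ Suc j \<and> (\<exists>p\<in>Q. p dvd i)}"
        using q(2) unfolding A_def Q_def Suc_m[symmetric] less_Suc_eq_le
        by (fastforce simp: mem_arith_prog_iff)
      then have "card {i. i \<le> m j \<and> (poly f ^^ i) t \<in> A} \<le>
          card {i. i < P ^ Suc j \<and> (\<exists>p\<in>Q. p dvd i)}"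
        by (intro card_mono) auto
      then have "a (m j) \<le> real (card {i. i < P ^ Suc j \<and> (\<exists>p\<in>Q. p dvd i)}) / real (P ^ Suc j)"
        unfolding a_def Suc_m by (intro divide_right_mono) auto
      also have "\<dots> = 1 - (\<Prod>p\<in>Q. 1 - 1 / real p)"
        using card_multiples_of_primes[OF Q(1-3) zero_less_Suc[of j], folded P_def] \<open>P > 1\<close>
        by simp
      also have "\<dots> \<le> delta_bound k"
        by (rule delta_bound_ge) (use Q in auto)
      finally show ?thesis .
    qed
    ultimately have "r \<le> delta_bound k"
      by (intro LIMSEQ_le_const2[of "\<lambda>j. a (m j)"]) auto
    then show False using \<open>delta_bound k < r\<close> by simp
  qed
qed

lemma orb_pm_translation: "orb_pm [:a, 1:] t = arith_prog t a"
  by (auto simp: orb_pm_def arith_prog_def mult.commute)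

theorem theorem6p6:
  fixes f :: "int poly" and t :: int and r :: real and k :: nat
  assumes "degree f \<ge> 2"
    and "wandering f t"
    and "0 < r" and "r < 1"
    and "k > 0"
    and "delta_bound k < r"
  shows "\<not> accessible f t k r \<and>
         \<not> (\<exists>g :: nat \<Rightarrow> int poly. (\<forall>i\<in>{1..k}. \<exists>a. g i = [:a, 1:]) \<and>
              has_orb_density f t (\<Union>i\<in>{1..k}. orb_pm (g i) t) r)"
proof -
  note no_density = not_has_orb_density_arith_progs[OF assms(1,2,4,5,6)]
  have "\<not> has_orb_density f t (\<Union>i\<in>{1..k}. orb_pm (g i) t) r"
    if g: "\<forall>i\<in>{1..k}. \<exists>a. g i = [:a, 1:]" for g :: "nat \<Rightarrow> int poly"
  proof -
    obtain a where "\<And>i. i \<in> {1..k} \<Longrightarrow> g i = [:a i, 1:]"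
      using g by metis
    then have "(\<Union>i\<in>{1..k}. orb_pm (g i) t) = (\<Union>i\<in>{1..k}. arith_prog t (a i))"
      by (simp add: orb_pm_translation)
    then show ?thesis using no_density by simp
  qed
  then show ?thesis
    using no_density by (auto simp: accessible_def)
qed

end
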